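(* Let $D$ be a skew field, $\sigma$ a ring automorphism of $D$, $\delta$ a $\sigma$-derivation of $D$. Assume that $R=D[X;\sigma,\delta]$ is generated, as an algebra over its center, by a finite set $\{d_1,\dots,d_s\}$. Let $f\in R$ be a bounded polynomial (i.e. $f^*\ne0$). Then the following algorithm terminates and correctly computes a bound $f^*$ of $f$: Start with $g\leftarrow f$, $i\leftarrow 1$. While $i\le s$: if $\operatorname{lrem}(g d_i,g)=0$, set $i\leftarrow i+1$; otherwise set $g\leftarrow [g_{d_i},g]_\ell$, where $g_{d_i}\in R$ satisfies $Rg_{d_i}=\operatorname{Ann}_R(d_i+Rg)$, and set $i\leftarrow 1$. When the loop ends, return $g$.
   Context: A $\sigma$-derivation is an additive map $\delta:D\to D$ with $\delta(ab)=\sigma(a)\delta(b)+\delta(a)b$. $R=D[X;\sigma,\delta]$ is the Ore polynomial ring: a left $D$-vector space with basis $\{X^n: n\ge 0\}$, with $Xa=\sigma(a)X+\delta(a)$ for $a\in D$. It is a left and right principal ideal domain. For $g\neq 0$, $\operatorname{lrem}(h,g)$ denotes the unique $\rho\in R$ with $\deg\rho<\deg g$ and $h=qg+\rho$ for some $q\in R$. $\operatorname{Ann}_R(d+Rg)=\{h\in R: hd\in Rg\}$ is the annihilator of the element $d+Rg$ of $R/Rg$. A polynomial $\alpha$ is twosided if $R\alpha=\alpha R$. A bound of $f\in R$ is a twosided polynomial $f^*$ such that $Rf^*=f^*R$ is the largest twosided ideal contained in $Rf$; equivalently $Rf^*=\operatorname{Ann}_R(R/Rf)$. It is determined up to left multiplication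 by nonzero elements of $D$; $f$ is bounded if $f^*\neq 0$. The left least common multiple $[g,h]_\ell$ is a generator of $Rg\cap Rh$. *)

theory Defs
  imports
    "HOL-Algebra.Generated_Rings"
    "HOL-Algebra.Ideal"
    "HOL-Computational_Algebra.Polynomial"
begin

text \<open>
  The skew field \<open>D\<close> is a type of class \<^class>\<open>division_ring\<close>. The Ore polynomial ring
  \<open>D[X;\<sigma>,\<delta>]\<close> depends on the values \<open>\<sigma>\<close> and \<open>\<delta>\<close>, so it is a ring record. Its carrier is
  \<open>'a poly\<close>, read as the left vector space of sums \<open>\<Sum>i. a\<^sub>i X\<^sup>i\<close> with coefficients on the left.
\<close>

definition ring_automorphism :: "('a::division_ring \<Rightarrow> 'a) \<Rightarrow> bool" where
  "ring_automorphism \<sigma> \<longleftrightarrow>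
     bij \<sigma> \<and> \<sigma> 1 = 1 \<and>
     (\<forall>a b. \<sigma> (a + b) = \<sigma> a + \<sigma> b) \<and> (\<forall>a b. \<sigma> (a * b) = \<sigma> a * \<sigma> b)"

definition sigma_derivation :: "('a::division_ring \<Rightarrow> 'a) \<Rightarrow> ('a \<Rightarrow> 'a) \<Rightarrow> bool" where
  "sigma_derivation \<sigma> \<delta> \<longleftrightarrow>
     (\<forall>a b. \<delta> (a + b) = \<delta> a + \<delta> b) \<and> (\<forall>a b. \<delta> (a * b) = \<sigma> a * \<delta> b + \<delta> a * b)"

text \<open>
  Left multiplication by a scalar. The library's \<open>smult\<close>, and the product and unit of
  \<open>'a poly\<close>, need commutative coefficients.
\<close>

definition lsmult :: "'a::division_ring \<Rightarrow> 'a poly \<Rightarrow> 'a poly" where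
  "lsmult a p = map_poly (\<lambda>c. a * c) p"

text \<open>Left multiplication by \<open>X\<close>: \<open>X \<cdot> (\<Sum>i. a\<^sub>i X\<^sup>i) = \<Sum>i. (\<sigma> a\<^sub>i X\<^bsup>i+1\<^esup> + \<delta> a\<^sub>i X\<^sup>i)\<close>.\<close>

definition ore_X_mult :: "('a::division_ring \<Rightarrow> 'a) \<Rightarrow> ('a \<Rightarrow> 'a) \<Rightarrow> 'a poly \<Rightarrow> 'a poly" where
  "ore_X_mult \<sigma> \<delta> p = pCons 0 (map_poly \<sigma> p) + map_poly \<delta> p"

definition ore_mult ::
    "('a::division_ring \<Rightarrow> 'a) \<Rightarrow> ('a \<Rightarrow> 'a) \<Rightarrow> 'a poly \<Rightarrow> 'a poly \<Rightarrow> 'a poly" where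
  "ore_mult \<sigma> \<delta> p q = (\<Sum>i\<le>degree p. lsmult (coeff p i) ((ore_X_mult \<sigma> \<delta> ^^ i) q))"

definition ore_ring :: "('a::division_ring \<Rightarrow> 'a) \<Rightarrow> ('a \<Rightarrow> 'a) \<Rightarrow> 'a poly ring" where
  "ore_ring \<sigma> \<delta> =
     \<lparr>carrier = UNIV, monoid.mult = ore_mult \<sigma> \<delta>, one = [:1:], zero = 0, add = (+)\<rparr>"

text \<open>
  For a ring \<open>R\<close>, the library's \<open>carrier R #>\<^bsub>R\<^esub> a\<close> is the left ideal \<open>Ra\<close> and
  \<open>a <#\<^bsub>R\<^esub> carrier R\<close> is the right ideal \<open>aR\<close>.
\<close>

definition ring_center :: "('b, 'm) ring_scheme \<Rightarrow> 'b set" where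
  "ring_center R = {z \<in> carrier R. \<forall>x \<in> carrier R. z \<otimes>\<^bsub>R\<^esub> x = x \<otimes>\<^bsub>R\<^esub> z}"

text \<open>The subalgebra over the center generated by \<open>S\<close> is the subring generated by the center and \<open>S\<close>.\<close>

definition generates_over_center :: "('b, 'm) ring_scheme \<Rightarrow> 'b set \<Rightarrow> bool" where
  "generates_over_center R S \<longleftrightarrow> generate_ring R (ring_center R \<union> S) = carrier R"

text \<open>The annihilator of the element \<open>d + Rg\<close> of the left module \<open>R/Rg\<close>.\<close>

definition ann_coset :: "('b, 'm) ring_scheme \<Rightarrow> 'b \<Rightarrow> 'b \<Rightarrow> 'b set" where
  "ann_coset R d g = {h \<in> carrier R. h \<otimes>\<^bsub>R\<^esub> d \<in> carrier R #>\<^bsub>R\<^esub> g}"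

definition is_llcm :: "('b, 'm) ring_scheme \<Rightarrow> 'b \<Rightarrow> 'b \<Rightarrow> 'b \<Rightarrow> bool" where
  "is_llcm R g h l \<longleftrightarrow> l \<in> carrier R \<and>
     carrier R #>\<^bsub>R\<^esub> l = (carrier R #>\<^bsub>R\<^esub> g) \<inter> (carrier R #>\<^bsub>R\<^esub> h)"

definition twosided :: "('b, 'm) ring_scheme \<Rightarrow> 'b \<Rightarrow> bool" where
  "twosided R a \<longleftrightarrow> a \<in> carrier R \<and> carrier R #>\<^bsub>R\<^esub> a = a <#\<^bsub>R\<^esub> carrier R"

definition is_bound :: "('b, 'm) ring_scheme \<Rightarrow> 'b \<Rightarrow> 'b \<Rightarrow> bool" where
  "is_bound R f b \<longleftrightarrow>
     twosided R b \<and>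
     ideal (carrier R #>\<^bsub>R\<^esub> b) R \<and>
     carrier R #>\<^bsub>R\<^esub> b \<subseteq> carrier R #>\<^bsub>R\<^esub> f \<and>
     (\<forall>I. ideal I R \<longrightarrow> I \<subseteq> carrier R #>\<^bsub>R\<^esub> f \<longrightarrow> I \<subseteq> carrier R #>\<^bsub>R\<^esub> b)"

definition bounded_elem :: "('b, 'm) ring_scheme \<Rightarrow> 'b \<Rightarrow> bool" where
  "bounded_elem R f \<longleftrightarrow> (\<exists>b. is_bound R f b \<and> b \<noteq> \<zero>\<^bsub>R\<^esub>)"

text \<open>
  The remainder \<open>r\<close> in \<open>h = qg + r\<close>, for \<open>g \<noteq> 0\<close>. The disjunct \<open>r = 0\<close> stands for
  \<open>deg 0 < deg g\<close>, because the library has \<open>degree 0 = 0\<close>.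
\<close>

definition lrem :: "'a::division_ring poly ring \<Rightarrow> 'a poly \<Rightarrow> 'a poly \<Rightarrow> 'a poly" where
  "lrem R h g = (THE r. (r = 0 \<or> degree r < degree g) \<and> (\<exists>q \<in> carrier R. h = q \<otimes>\<^bsub>R\<^esub> g \<oplus>\<^bsub>R\<^esub> r))"

text \<open>
  One iteration of the loop, on states \<open>(g, i)\<close>. It is a relation because the generators of
  \<open>Ann(d\<^sub>i + Rg)\<close> and of the intersection are determined only up to nonzero left scalars. There is no step
  from a state with \<open>i > s\<close>, where the loop ends, nor from one with \<open>g = 0\<close>, where
  the remainder is undefined.
\<close>

inductive bound_step ::
    "'a::division_ring poly ring \<Rightarrow> nat \<Rightarrow> (nat \<Rightarrow> 'a poly) \<Rightarrow>
     'a poly \<times> nat \<Rightarrow> 'a poly \<times> nat \<Rightarrow> bool"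
  for R s d where
  advance: "\<lbrakk>i \<le> s; g \<noteq> 0; lrem R (g \<otimes>\<^bsub>R\<^esub> d i) g = 0\<rbrakk> \<Longrightarrow> bound_step R s d (g, i) (g, i + 1)"
| enlarge: "\<lbrakk>i \<le> s; g \<noteq> 0; lrem R (g \<otimes>\<^bsub>R\<^esub> d i) g \<noteq> 0;
             gd \<in> carrier R; carrier R #>\<^bsub>R\<^esub> gd = ann_coset R (d i) g;
             is_llcm R gd g l\<rbrakk> \<Longrightarrow> bound_step R s d (g, i) (l, 1)"

text \<open>\<open>ore_ring\<close> is a ring with the commutation rule and the left basis \<open>(X\<^sup>n)\<close> of \<open>D[X;\<sigma>,\<delta>]\<close>.\<close>

locale ore_data =
  fixes \<sigma> \<delta> :: "'a::division_ring \<Rightarrow> 'a"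
  assumes aut: "ring_automorphism \<sigma>" and der: "sigma_derivation \<sigma> \<delta>"
begin

abbreviation T where "T \<equiv> ore_X_mult \<sigma> \<delta>"
abbreviation L where "L \<equiv> ore_mult \<sigma> \<delta>"

lemma sigma_simps [simp]:
  "\<sigma> 1 = 1" "\<sigma> (a + b) = \<sigma> a + \<sigma> b" "\<sigma> (a * b) = \<sigma> a * \<sigma> b" "\<sigma> 0 = 0"
proof -
  show add: "\<sigma> (a + b) = \<sigma> a + \<sigma> b" for a b
    using aut by (simp add: ring_automorphism_def)
  show "\<sigma> 1 = 1" "\<sigma> (a * b) = \<sigma> a * \<sigma> b"
    using aut by (auto simp: ring_automorphism_def)
  show "\<sigma> 0 = 0" using add[of 0 0] by simp
qed

lemma delta_simps [simp]:
  "\<delta> (a + b) = \<delta> a + \<delta> b" "\<delta> (a * b) = \<sigma> a * \<delta> b + \<delta> a * b" "\<delta> 0 = 0" "\<delta> 1 = 0"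
proof -
  show add: "\<delta> (a + b) = \<delta> a + \<delta> b" for a b
    using der by (simp add: sigma_derivation_def)
  show mult: "\<delta> (a * b) = \<sigma> a * \<delta> b + \<delta> a * b" for a b
    using der by (simp add: sigma_derivation_def)
  show "\<delta> 0 = 0" using add[of 0 0] by simp
  show "\<delta> 1 = 0" using mult[of 1 1] by simp
qed

lemma coeff_lsmult [simp]: "coeff (lsmult a p) n = a * coeff p n"
  by (simp add: lsmult_def coeff_map_poly)

lemma coeff_T: "coeff (T p) n = (if n = 0 then 0 else \<sigma> (coeff p (n - 1))) + \<delta> (coeff p n)"
  by (simp add: ore_X_mult_def coeff_map_poly coeff_pCons')

lemma T_add: "T (p + q) = T p + T q"
  by (rule poly_eqI) (simp add: coeff_T)

lemma T_0 [simp]: "T 0 = 0"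
  by (rule poly_eqI) (simp add: coeff_T)

lemma T_lsmult: "T (lsmult a p) = lsmult (\<sigma> a) (T p) + lsmult (\<delta> a) p"
  by (rule poly_eqI) (simp add: coeff_T algebra_simps)

lemma T_sum: "T (sum h A) = (\<Sum>i\<in>A. T (h i))"
  by (induction A rule: infinite_finite_induct) (simp_all add: T_add)

lemma Tn_add: "(T ^^ i) (p + q) = (T ^^ i) p + (T ^^ i) q"
  by (induction i) (simp_all add: T_add)

lemma lsmult_add: "lsmult a (p + q) = lsmult a p + lsmult a q"
  and lsmult_add_left: "lsmult (a + b) p = lsmult a p + lsmult b p"
  and lsmult_lsmult: "lsmult a (lsmult b p) = lsmult (a * b) p"
  and lsmult_0 [simp]: "lsmult 0 p = 0"
  and lsmult_0_right [simp]: "lsmult a 0 = 0"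
  and lsmult_1 [simp]: "lsmult 1 p = p"
  by (rule poly_eqI, simp add: algebra_simps mult.assoc)+

lemma lsmult_sum: "lsmult a (sum h A) = (\<Sum>i\<in>A. lsmult a (h i))"
  by (induction A rule: infinite_finite_induct) (simp_all add: lsmult_add)

lemma L_eq:
  assumes "degree p \<le> n"
  shows "L p q = (\<Sum>i\<le>n. lsmult (coeff p i) ((T ^^ i) q))"
  unfolding ore_mult_def using assms
  by (intro sum.mono_neutral_left) (auto simp: coeff_eq_0)

lemma L_add_left: "L (p + p') q = L p q + L p' q"
proof -
  define n where "n = max (degree p) (degree p')"
  have "degree (p + p') \<le> n" "degree p \<le> n" "degree p' \<le> n"
    by (auto simp: n_def degree_add_le)
  then show ?thesis
    by (simp add: L_eq[of _ n] lsmult_add_left sum.distrib)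
qed

lemma L_add_right: "L p (q + q') = L p q + L p q'"
  by (simp add: ore_mult_def Tn_add lsmult_add sum.distrib)

lemma L_0_left [simp]: "L 0 q = 0"
  by (simp add: ore_mult_def)

lemma L_sum_left: "L (sum h A) q = (\<Sum>i\<in>A. L (h i) q)"
  by (induction A rule: infinite_finite_induct) (simp_all add: L_add_left)

lemma L_lsmult_left: "L (lsmult a p) q = lsmult a (L p q)"
proof -
  have "degree (lsmult a p) \<le> degree p"
    by (rule degree_le) (auto simp: coeff_eq_0)
  from L_eq[OF this] show ?thesis
    by (simp add: ore_mult_def lsmult_sum lsmult_lsmult)
qed

lemma L_T_left: "L (T p) q = T (L p q)"
proof -
  let ?n = "degree p"
  have "degree (T p) \<le> Suc ?n"
    by (rule degree_le) (auto simp: coeff_T coeff_eq_0)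
  from L_eq[OF this]
  have "L (T p) q = (\<Sum>i\<le>Suc ?n. lsmult (if i = 0 then 0 else \<sigma> (coeff p (i - 1))) ((T ^^ i) q))
      + (\<Sum>i\<le>Suc ?n. lsmult (\<delta> (coeff p i)) ((T ^^ i) q))"
    by (simp add: coeff_T lsmult_add_left sum.distrib del: sum.atMost_Suc)
  also have "(\<Sum>i\<le>Suc ?n. lsmult (if i = 0 then 0 else \<sigma> (coeff p (i - 1))) ((T ^^ i) q))
      = (\<Sum>i\<le>?n. lsmult (\<sigma> (coeff p i)) (T ((T ^^ i) q)))"
    by (subst sum.atMost_Suc_shift) simp
  also have "(\<Sum>i\<le>Suc ?n. lsmult (\<delta> (coeff p i)) ((T ^^ i) q))
      = (\<Sum>i\<le>?n. lsmult (\<delta> (coeff p i)) ((T ^^ i) q))"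
    by (simp add: coeff_eq_0)
  finally show ?thesis
    by (simp add: ore_mult_def T_sum T_lsmult sum.distrib)
qed

lemma L_Tn_left: "L ((T ^^ i) p) q = (T ^^ i) (L p q)"
  by (induction i) (simp_all add: L_T_left)

lemma L_assoc: "L (L p q) r = L p (L q r)"
proof -
  have "L (L p q) r = (\<Sum>i\<le>degree p. L (lsmult (coeff p i) ((T ^^ i) q)) r)"
    by (subst ore_mult_def[of _ _ p q]) (rule L_sum_left)
  then show ?thesis
    by (simp add: L_lsmult_left L_Tn_left ore_mult_def[of _ _ p])
qed

lemma L_const: "L [:a:] q = lsmult a q"
  by (simp add: ore_mult_def)

lemma T_monom: "T (monom 1 n) = monom 1 (Suc n)"
  by (rule poly_eqI) (auto simp: coeff_T)

lemma Tn_one: "(T ^^ i) [:1:] = monom 1 i"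
  by (induction i) (simp_all add: T_monom monom_0)

lemma lsmult_monom: "lsmult a (monom 1 n) = monom a n"
  by (rule poly_eqI) simp

lemma L_one_right: "L p [:1:] = p"
  by (simp add: ore_mult_def Tn_one lsmult_monom poly_as_sum_of_monoms)

abbreviation R where "R \<equiv> ore_ring \<sigma> \<delta>"

lemma ring_ore_ring: "ring R"
proof (rule ringI)
  show "abelian_group R"
  proof (rule abelian_groupI)
    show "\<exists>y\<in>carrier R. y \<oplus>\<^bsub>R\<^esub> x = \<zero>\<^bsub>R\<^esub>" for x
      by (auto simp: ore_ring_def intro: exI[of _ "- x"])
  qed (auto simp: ore_ring_def algebra_simps)
  show "monoid R"
    by (rule monoidI) (auto simp: ore_ring_def L_assoc L_const L_one_right)
qed (auto simp: ore_ring_def L_add_left L_add_right)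

lemma ore_X_const: "monom 1 1 \<otimes>\<^bsub>R\<^esub> [:a:] = [:\<sigma> a:] \<otimes>\<^bsub>R\<^esub> monom 1 1 \<oplus>\<^bsub>R\<^esub> [:\<delta> a:]"
proof -
  have "L (monom 1 1) [:a:] = T [:a:]"
    using L_T_left[of "[:1:]" "[:a:]"] T_monom[of 0] by (simp add: L_const monom_0)
  moreover have "T [:a:] = monom (\<sigma> a) 1 + [:\<delta> a:]"
    by (rule poly_eqI) (auto simp: coeff_T coeff_pCons')
  ultimately show ?thesis
    by (simp add: ore_ring_def L_const lsmult_monom)
qed

lemma ore_const_mult: "[:a:] \<otimes>\<^bsub>R\<^esub> [:b:] = [:a * b:]"
  by (rule poly_eqI) (simp add: ore_ring_def L_const coeff_pCons')

lemma ore_X_pow: "monom 1 1 [^]\<^bsub>R\<^esub> (n::nat) = monom 1 n"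
proof (induction n)
  case 0
  show ?case by (simp add: ore_ring_def monom_0 nat_pow_def)
next
  case (Suc n)
  interpret ring R by (rule ring_ore_ring)
  have "L (monom 1 n) (monom 1 1) = (T ^^ n) (L [:1:] (monom 1 1))"
    by (subst Tn_one[symmetric], rule L_Tn_left)
  also have "\<dots> = (T ^^ n) (T [:1:])"
    using T_monom[of 0] by (simp add: L_const monom_0)
  also have "\<dots> = monom 1 (Suc n)"
    using Tn_one[of "Suc n"] by (simp add: funpow_swap1)
  finally show ?case
    using Suc by (simp add: ore_ring_def nat_pow_def)
qed

lemma ore_basis: "(\<Sum>i\<le>degree p. [:coeff p i:] \<otimes>\<^bsub>R\<^esub> (monom 1 1 [^]\<^bsub>R\<^esub> i)) = p"
  unfolding ore_X_pow by (simp add: ore_ring_def L_const lsmult_monom poly_as_sum_of_monoms)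

lemma ore_basis_coeff:
  "coeff (\<Sum>i\<le>n. [:a i:] \<otimes>\<^bsub>R\<^esub> (monom 1 1 [^]\<^bsub>R\<^esub> i)) j = (if j \<le> n then a j else 0)"
  unfolding ore_X_pow by (simp add: ore_ring_def L_const lsmult_monom coeff_sum)

end

end

theory Submission
  imports Defs
begin

text \<open>
  Every \<open>g\<close> met by the loop satisfies \<open>Rf\<^sup>* \<subseteq> Rg \<subseteq> Rf\<close>: an element \<open>h\<close> of the twosided ideal
  \<open>Rf\<^sup>*\<close> has \<open>h d\<^sub>i \<in> Rf\<^sup>* \<subseteq> Rg\<close>, so it lies in \<open>Ann(d\<^sub>i + Rg)\<close>. An enlarging step strictly
  shrinks \<open>Rg\<close>, so the degree of \<open>g\<close> grows, and it is bounded by the degree of \<open>f\<^sup>*\<close>. When the loop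
  ends, the idealizer \<open>{h. gh \<in> Rg}\<close> is a subring containing the center and all \<open>d\<^sub>i\<close>, hence
  everything. So \<open>Rg\<close> is a twosided ideal inside \<open>Rf\<close>, and thus \<open>Rg = Rf\<^sup>*\<close>.
\<close>

context ore_data
begin

section \<open>Left and right multiples in the Ore ring\<close>

lemma ore_ring_simps [simp]:
  "carrier R = UNIV" "p \<otimes>\<^bsub>R\<^esub> q = L p q" "\<one>\<^bsub>R\<^esub> = [:1:]" "\<zero>\<^bsub>R\<^esub> = 0" "p \<oplus>\<^bsub>R\<^esub> q = p + q"
  by (simp_all add: ore_ring_def)

lemma left_multiples: "UNIV #>\<^bsub>R\<^esub> g = range (\<lambda>q. L q g)"
  by (auto simp: r_coset_def)

lemma right_multiples: "g <#\<^bsub>R\<^esub> UNIV = range (L g)"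
  by (auto simp: l_coset_def)

lemma left_multiples_add:
  "p \<in> range (\<lambda>q. L q g) \<Longrightarrow> p' \<in> range (\<lambda>q. L q g) \<Longrightarrow> p + p' \<in> range (\<lambda>q. L q g)"
  by (auto simp flip: L_add_left)

lemma left_multiples_mult: "p \<in> range (\<lambda>q. L q g) \<Longrightarrow> L h p \<in> range (\<lambda>q. L q g)"
  by (auto simp flip: L_assoc)

lemma L_minus_left: "L (- p) q = - L p q"
  using L_add_left[of "- p" p q] by (simp add: eq_neg_iff_add_eq_0)

lemma L_diff_left: "L (p - p') q = L p q - L p' q"
  using L_add_left[of p "- p'" q] by (simp add: L_minus_left)

lemma L_0_right [simp]: "L p 0 = 0"
  using L_add_right[of p 0 0] by simp

lemma L_minus_right: "L p (- q) = - L p q"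
  using L_add_right[of p "- q" q] by (simp add: eq_neg_iff_add_eq_0)

lemma L_one_left: "L [:1:] q = q"
  by (simp add: L_const)

section \<open>Degrees of products\<close>

lemma sigma_eq_0_iff [simp]: "\<sigma> a = 0 \<longleftrightarrow> a = 0"
  using aut sigma_simps(4) by (metis ring_automorphism_def bij_is_inj injD)

lemma sigma_pow_eq_0_iff [simp]: "(\<sigma> ^^ n) a = 0 \<longleftrightarrow> a = 0"
  by (induction n) simp_all

lemma coeff_Tn_above: "degree q + n < k \<Longrightarrow> coeff ((T ^^ n) q) k = 0"
proof (induction n arbitrary: k)
  case (Suc n)
  then show ?case by (simp add: coeff_T)
qed (simp add: coeff_eq_0)

lemma coeff_Tn_lead: "coeff ((T ^^ n) q) (degree q + n) = (\<sigma> ^^ n) (lead_coeff q)"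
  by (induction n) (simp_all add: coeff_T coeff_Tn_above)

text \<open>Only the term \<open>i = degree p\<close> reaches the exponent
  \<open>degree p + degree q\<close>. Moving the leading coefficient of \<open>q\<close> past that
  power of X twists it by \<open>\<sigma> ^^ degree p\<close>.\<close>

lemma coeff_L_lead:
  "coeff (L p q) (degree p + degree q) = lead_coeff p * (\<sigma> ^^ degree p) (lead_coeff q)"
proof -
  have "coeff (L p q) (degree p + degree q) =
      (\<Sum>i\<le>degree p. coeff p i * coeff ((T ^^ i) q) (degree p + degree q))"
    by (simp add: ore_mult_def coeff_sum)
  also have "\<dots> = (\<Sum>i\<in>{degree p}. coeff p i * coeff ((T ^^ i) q) (degree p + degree q))"
    by (rule sum.mono_neutral_right) (auto simp: coeff_Tn_above)
  finally show ?thesis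
    using coeff_Tn_lead[of "degree p" q] by (simp add: add.commute)
qed

lemma degree_L_le: "degree (L p q) \<le> degree p + degree q"
  by (rule degree_le) (simp add: ore_mult_def coeff_sum coeff_Tn_above)

text \<open>\<open>\<sigma>\<close> is injective and D has no zero divisors, so the coefficient from
  \<open>coeff_L_lead\<close> survives. Hence the Ore ring is a domain.\<close>

lemma
  assumes "p \<noteq> 0" "q \<noteq> 0"
  shows degree_L: "degree (L p q) = degree p + degree q" and L_nonzero: "L p q \<noteq> 0"
proof -
  have nz: "coeff (L p q) (degree p + degree q) \<noteq> 0"
    using assms by (simp add: coeff_L_lead)
  then show "degree (L p q) = degree p + degree q"
    using degree_L_le le_degree by (intro antisym) blast+
  show "L p q \<noteq> 0"
    using nz by auto
qed

lemma L_right_cancel: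
  assumes "L p q = L p' q" "q \<noteq> 0"
  shows "p = p'"
proof (rule ccontr)
  assume "p \<noteq> p'"
  with assms(2) L_nonzero[of "p - p'" q] have "L (p - p') q \<noteq> 0" by simp
  with assms(1) show False by (simp add: L_diff_left)
qed

section \<open>Division with remainder\<close>

lemma right_division_exists:
  assumes "g \<noteq> 0"
  shows "\<exists>q r. (r = 0 \<or> degree r < degree g) \<and> h = L q g + r"
proof (induction "degree h" arbitrary: h rule: less_induct)
  case less
  show ?case
  proof (cases "h = 0 \<or> degree h < degree g")
    case True
    then have "(h = 0 \<or> degree h < degree g) \<and> h = L 0 g + h" by simp
    then show ?thesis by blast
  next
    case False
    define m where "m = degree h - degree g"
    \<comment> \<open>The coefficient turns \<open>(\<sigma> ^^ m) (lead_coeff g)\<close> into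
      \<open>lead_coeff h\<close> by left multiplication, so subtracting \<open>L k g\<close>
      cancels the leading term of \<open>h\<close>.\<close>
    define k where "k = monom (lead_coeff h * inverse ((\<sigma> ^^ m) (lead_coeff g))) m"
    have k0: "k \<noteq> 0" and dk: "degree k = m"
      and lk: "lead_coeff k = lead_coeff h * inverse ((\<sigma> ^^ m) (lead_coeff g))"
      using False assms by (auto simp: k_def degree_monom_eq)
    have deg: "degree k + degree g = degree h"
      using False by (simp add: dk m_def)
    have "coeff (L k g) (degree h) = lead_coeff h"
      using coeff_L_lead[of k g] assms unfolding deg lk by (simp add: dk mult.assoc)
    moreover have "degree (h - L k g) \<le> degree h"
      using degree_L_le[of k g] by (simp add: deg degree_diff_le)
    ultimately have small: "h - L k g = 0 \<or> degree (h - L k g) < degree h"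
      by (intro eq_zero_or_degree_less) auto
    show ?thesis
    proof (cases "h - L k g = 0")
      case True
      then have "h = L k g + 0" by simp
      then show ?thesis by blast
    next
      case False
      with small less obtain q r
        where "r = 0 \<or> degree r < degree g" "h - L k g = L q g + r"
        by blast
      then have "(r = 0 \<or> degree r < degree g) \<and> h = L (k + q) g + r"
        by (simp add: L_add_left algebra_simps)
      then show ?thesis by blast
    qed
  qed
qed

lemma right_remainder_unique:
  assumes "g \<noteq> 0"
    and "r = 0 \<or> degree r < degree g" "r' = 0 \<or> degree r' < degree g"
    and "L q g + r = L q' g + r'"
  shows "r = r'"
proof -
  have eq: "L (q - q') g = r' - r"
    using assms(4) by (simp add: L_diff_left algebra_simps)
  have small: "r' - r = 0 \<or> degree (r' - r) < degree g"
    using assms(2,3) degree_diff_less[of r' "degree g" r] by auto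
  \<comment> \<open>If \<open>q - q'\<close> were nonzero, its product with \<open>g\<close> would
    have degree at least \<open>degree g\<close>, against the bound on
    \<open>r' - r\<close>.\<close>
  have "q - q' = 0"
  proof (rule ccontr)
    assume "q - q' \<noteq> 0"
    with assms(1) have "L (q - q') g \<noteq> 0" "degree g \<le> degree (L (q - q') g)"
      by (simp_all add: L_nonzero degree_L)
    with small show False
      by (simp add: eq)
  qed
  with eq show ?thesis by simp
qed

text \<open>Existence and uniqueness of the remainder together evaluate the definite description.
  This turns the test of the loop into membership in Rg.\<close>

lemma lrem_eq_0_iff:
  assumes "g \<noteq> 0"
  shows "lrem R h g = 0 \<longleftrightarrow> h \<in> range (\<lambda>q. L q g)"
proof -
  let ?P = "\<lambda>r. (r = 0 \<or> degree r < degree g) \<and> (\<exists>q. h = L q g + r)"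
  obtain r where r: "?P r"
    using right_division_exists[OF assms] by blast
  have unique: "r' = r" if "?P r'" for r'
    using that r right_remainder_unique[OF assms] by metis
  have "lrem R h g = r"
    unfolding lrem_def ore_ring_simps bex_UNIV by (rule the_equality[where P = ?P, OF r unique])
  moreover have "r = 0 \<longleftrightarrow> h \<in> range (\<lambda>q. L q g)"
    using r unique[of 0] by auto
  ultimately show ?thesis by simp
qed

section \<open>Principal left ideals\<close>

lemma left_ideal_principal:
  assumes "I \<noteq> {}"
    and add: "\<And>p q. p \<in> I \<Longrightarrow> q \<in> I \<Longrightarrow> p + q \<in> I"
    and mult: "\<And>p q. q \<in> I \<Longrightarrow> L p q \<in> I"
  shows "\<exists>a. I = range (\<lambda>q. L q a)"
proof (cases "I \<subseteq> {0}")
  case True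
  with assms(1) have "I = {0}" by blast
  then show ?thesis
    by (intro exI[of _ 0]) auto
next
  case False
  \<comment> \<open>A nonzero element of least degree generates: remainders on division by it stay
    in \<open>I\<close> and must therefore vanish.\<close>
  then obtain a where a: "a \<in> I" "a \<noteq> 0" and least: "\<And>p. p \<in> I \<Longrightarrow> p \<noteq> 0 \<Longrightarrow> degree a \<le> degree p"
    using ex_has_least_nat[of "\<lambda>p. p \<in> I \<and> p \<noteq> 0" _ degree] by blast
  have "h \<in> range (\<lambda>q. L q a)" if "h \<in> I" for h
  proof -
    obtain q r where qr: "r = 0 \<or> degree r < degree a" "h = L q a + r"
      using right_division_exists[OF a(2)] by blast
    \<comment> \<open>The difference is written as a sum because only closure under addition and
      left multiplication is assumed.\<close>
    then have "r = h + L (- q) a"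
      by (simp add: L_minus_left)
    with that a(1) have "r \<in> I"
      by (simp add: add mult)
    with qr(1) least[of r] have "r = 0" by fastforce
    with qr(2) show ?thesis by simp
  qed
  with a(1) mult show ?thesis by blast
qed

lemma self_left_multiple: "g \<in> range (\<lambda>q. L q g)"
  using rangeI[of "\<lambda>q. L q g" "[:1:]"] by (simp add: L_one_left)

lemma left_multiples_subset_iff:
  "range (\<lambda>q. L q g) \<subseteq> range (\<lambda>q. L q f) \<longleftrightarrow> g \<in> range (\<lambda>q. L q f)"
proof
  assume "range (\<lambda>q. L q g) \<subseteq> range (\<lambda>q. L q f)"
  with self_left_multiple show "g \<in> range (\<lambda>q. L q f)" by (rule subsetD[rotated])
next
  assume "g \<in> range (\<lambda>q. L q f)"
  then show "range (\<lambda>q. L q g) \<subseteq> range (\<lambda>q. L q f)"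
    using left_multiples_mult by (simp add: image_subset_iff)
qed

text \<open>If the degree did not grow, the quotient would be a nonzero constant, hence a unit, and
  \<open>g\<close> would be a left multiple of \<open>l\<close>.\<close>

lemma degree_less_of_proper_left_multiple:
  assumes "l \<in> range (\<lambda>q. L q g)" "g \<notin> range (\<lambda>q. L q l)" "l \<noteq> 0" "g \<noteq> 0"
  shows "degree g < degree l"
proof (rule ccontr)
  obtain q where q: "l = L q g" using assms(1) by blast
  with assms(3) have "q \<noteq> 0" by auto
  assume "\<not> degree g < degree l"
  with degree_L[OF \<open>q \<noteq> 0\<close> assms(4)] q have "degree q = 0" by simp
  then obtain c where c: "q = [:c:]" using degree_eq_zeroE by blast
  with \<open>q \<noteq> 0\<close> q have "L [:inverse c:] l = g"
    by (simp add: L_const lsmult_lsmult)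
  with assms(2) show False by blast
qed

lemma ex_left_generator_ann_coset: "\<exists>a. UNIV #>\<^bsub>R\<^esub> a = ann_coset R d g"
proof -
  have "\<exists>a. ann_coset R d g = range (\<lambda>q. L q a)"
  proof (rule left_ideal_principal)
    have "0 \<in> ann_coset R d g"
      by (auto simp: ann_coset_def left_multiples intro: range_eqI[of _ _ 0])
    then show "ann_coset R d g \<noteq> {}" by blast
  next
    fix p q
    show "p + q \<in> ann_coset R d g" if "p \<in> ann_coset R d g" "q \<in> ann_coset R d g"
      using that left_multiples_add by (simp add: ann_coset_def left_multiples L_add_left)
    show "L p q \<in> ann_coset R d g" if "q \<in> ann_coset R d g"
      using that left_multiples_mult by (simp add: ann_coset_def left_multiples L_assoc)
  qed
  then show ?thesis by (auto simp: left_multiples)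
qed

lemma ex_llcm: "\<exists>l. is_llcm R g h l"
proof -
  have "\<exists>a. range (\<lambda>q. L q g) \<inter> range (\<lambda>q. L q h) = range (\<lambda>q. L q a)"
  proof (rule left_ideal_principal)
    have "0 \<in> range (\<lambda>q. L q g) \<inter> range (\<lambda>q. L q h)"
      using L_0_left by (metis IntI rangeI)
    then show "range (\<lambda>q. L q g) \<inter> range (\<lambda>q. L q h) \<noteq> {}" by blast
  next
    fix p q
    show "p + q \<in> range (\<lambda>q. L q g) \<inter> range (\<lambda>q. L q h)"
      if "p \<in> range (\<lambda>q. L q g) \<inter> range (\<lambda>q. L q h)"
        "q \<in> range (\<lambda>q. L q g) \<inter> range (\<lambda>q. L q h)"
      using that by (blast intro: left_multiples_add)
    show "L p q \<in> range (\<lambda>q. L q g) \<inter> range (\<lambda>q. L q h)"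
      if "q \<in> range (\<lambda>q. L q g) \<inter> range (\<lambda>q. L q h)"
      using that by (blast intro: left_multiples_mult)
  qed
  then show ?thesis by (simp add: is_llcm_def left_multiples) metis
qed

section \<open>Idealizers and twosided ideals\<close>

lemma subring_idealizer: "subring {h. L g h \<in> range (\<lambda>q. L q g)} R"
proof -
  interpret ring R by (rule ring_ore_ring)
  \<comment> \<open>The inverse in the record comes from its additive group, so it is first
    identified with polynomial negation.\<close>
  have neg: "\<ominus>\<^bsub>R\<^esub> h = - h" for h
    by (rule minus_equality) simp_all
  show ?thesis
  proof (rule subringI)
    show "{h. L g h \<in> range (\<lambda>q. L q g)} \<subseteq> carrier R" by simp
    show "\<one>\<^bsub>R\<^esub> \<in> {h. L g h \<in> range (\<lambda>q. L q g)}"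
      by (simp add: L_one_right self_left_multiple)
  next
    fix h assume "h \<in> {h. L g h \<in> range (\<lambda>q. L q g)}"
    then obtain q where "L g h = L q g" by blast
    then have "L g (- h) = L (- q) g" by (simp add: L_minus_left L_minus_right)
    then show "\<ominus>\<^bsub>R\<^esub> h \<in> {h. L g h \<in> range (\<lambda>q. L q g)}" by (auto simp: neg)
  next
    fix h k
    assume "h \<in> {h. L g h \<in> range (\<lambda>q. L q g)}" "k \<in> {h. L g h \<in> range (\<lambda>q. L q g)}"
    then obtain p q where "L g h = L p g" "L g k = L q g" by blast
    \<comment> \<open>One factor at a time moves past \<open>g\<close>: g(hk) = (pg)k = p(gk) =
      (pq)g.\<close>
    then have "L g (L h k) = L (L p q) g" "L g (h + k) = L (p + q) g"
      by (simp_all add: L_assoc L_add_left L_add_right flip: L_assoc[of g h k])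
    then show "h \<otimes>\<^bsub>R\<^esub> k \<in> {h. L g h \<in> range (\<lambda>q. L q g)}"
      and "h \<oplus>\<^bsub>R\<^esub> k \<in> {h. L g h \<in> range (\<lambda>q. L q g)}"
      by auto
  qed
qed

lemma idealizer_eq_UNIV:
  assumes "generates_over_center R S" "\<And>x. x \<in> S \<Longrightarrow> L g x \<in> range (\<lambda>q. L q g)"
  shows "L g h \<in> range (\<lambda>q. L q g)"
proof -
  interpret ring R by (rule ring_ore_ring)
  \<comment> \<open>A central z satisfies gz = zg, so the center lies in the idealizer for every
    \<open>g\<close>.\<close>
  have "ring_center R \<union> S \<subseteq> {h. L g h \<in> range (\<lambda>q. L q g)}"
    using assms(2) by (auto simp: ring_center_def) (metis rangeI)
  then have "generate_ring R (ring_center R \<union> S) \<subseteq> {h. L g h \<in> range (\<lambda>q. L q g)}"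
    by (rule generate_ring_min_subring1[OF _ subring_idealizer, rotated]) simp_all
  with assms(1) show ?thesis
    by (auto simp: generates_over_center_def)
qed

text \<open>Right absorption only has to be tested on the generator, since (pg)x = p(gx).\<close>

lemma ideal_left_multiples:
  assumes "\<And>h. L g h \<in> range (\<lambda>q. L q g)"
  shows "ideal (range (\<lambda>q. L q g)) R"
proof -
  interpret ring R by (rule ring_ore_ring)
  have neg: "inv\<^bsub>add_monoid R\<^esub> h = - h" for h
    using minus_equality[of "- h" h] by (simp add: a_inv_def)
  show ?thesis
  proof (rule idealI)
    show "ring R" by (rule ring_ore_ring)
    show "subgroup (range (\<lambda>q. L q g)) (add_monoid R)"
    proof (rule group.subgroupI)
      show "Group.group (add_monoid R)" by (rule add.is_group)
    next
      fix a assume "a \<in> range (\<lambda>q. L q g)"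
      then show "inv\<^bsub>add_monoid R\<^esub> a \<in> range (\<lambda>q. L q g)"
        unfolding neg by (auto simp flip: L_minus_left)
    qed (auto simp flip: L_add_left)
  next
    fix a x assume "a \<in> range (\<lambda>q. L q g)"
    then obtain p where p: "a = L p g" by blast
    then show "x \<otimes>\<^bsub>R\<^esub> a \<in> range (\<lambda>q. L q g)"
      by (simp add: left_multiples_mult)
    obtain q where "L g x = L q g" using assms by blast
    then have "L a x = L (L p q) g" by (simp add: p L_assoc)
    then show "a \<otimes>\<^bsub>R\<^esub> x \<in> range (\<lambda>q. L q g)" by simp
  qed
qed

text \<open>Twosidedness of \<open>g\<close> means Rg = gR, which equality of left ideals does not
  give at once. The inclusion of gR in Rg is assumed; the converse is carried over from Rb = bR by
  \<open>u\<close> and \<open>v\<close> with uv = 1.\<close>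

lemma is_bound_cong:
  assumes "is_bound R f b" "b \<noteq> 0" and eq: "range (\<lambda>q. L q g) = range (\<lambda>q. L q b)"
    and right: "\<And>h. L g h \<in> range (\<lambda>q. L q g)"
  shows "is_bound R f g"
proof -
  obtain u v where u: "g = L u b" and v: "b = L v g"
    using eq self_left_multiple by blast
  have "L g h \<in> range (\<lambda>q. L q g) \<and> L h g \<in> range (L g)" for h
  proof
    have "g \<noteq> 0"
      using v \<open>b \<noteq> 0\<close> by auto
    moreover have "L (L u v) g = L [:1:] g"
      using u v by (simp add: L_assoc L_one_left)
    ultimately have uv: "L u v = [:1:]"
      using L_right_cancel by blast
    have "L (L v (L h u)) b \<in> range (L b)"
      using assms(1) by (auto simp: is_bound_def twosided_def left_multiples right_multiples)
    then obtain t where t: "L (L v (L h u)) b = L b t" by blast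
    \<comment> \<open>Inserting uv = 1 and g = ub puts vhu in front of \<open>b\<close>, where Rb =
      bR applies; the remaining ub is \<open>g\<close> again.\<close>
    have "L h g = L (L u v) (L h g)"
      by (simp add: uv L_one_left)
    also have "\<dots> = L u (L (L v (L h u)) b)"
      by (simp add: u L_assoc)
    also have "\<dots> = L g t"
      by (simp add: t[unfolded L_assoc] u L_assoc)
    finally show "L h g \<in> range (L g)" by blast
  qed (rule right)
  then have gR: "g <#\<^bsub>R\<^esub> UNIV = UNIV #>\<^bsub>R\<^esub> g"
    unfolding left_multiples right_multiples by blast
  have Rg: "UNIV #>\<^bsub>R\<^esub> g = UNIV #>\<^bsub>R\<^esub> b"
    using eq by (simp add: left_multiples)
  show ?thesis
    using assms(1) unfolding is_bound_def twosided_def ore_ring_simps(1) gR Rg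
    by - (elim conjE, intro conjI refl UNIV_I; assumption)
qed

section \<open>Invariant, termination and outcome of the loop\<close>

text \<open>Here \<open>b\<close> is meant to be a nonzero bound of \<open>f\<close>; the inclusions
  of left ideals are expressed by their generators. The last clause records the tests passed for the
  current \<open>g\<close>. It is vacuous at index 1, so it survives the reset after an
  enlargement.\<close>

definition loop_invariant :: "(nat \<Rightarrow> 'a poly) \<Rightarrow> 'a poly \<Rightarrow> 'a poly \<Rightarrow> 'a poly \<times> nat \<Rightarrow> bool" where
  "loop_invariant d f b = (\<lambda>(g, i). g \<in> range (\<lambda>q. L q f) \<and> b \<in> range (\<lambda>q. L q g) \<and>
     (\<forall>j\<in>{1..<i}. L g (d j) \<in> range (\<lambda>q. L q g)))"

text \<open>The failed test keeps \<open>g\<close> out of the annihilator, hence out of Rl, so Rl is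
  strictly smaller than Rg. The element \<open>b\<close> stays in Rl because Rb absorbs
  \<open>d i\<close> on the right.\<close>

lemma enlarge_step:
  assumes bound: "is_bound R f b" "b \<noteq> 0"
    and inv: "loop_invariant d f b (g, i)" and "g \<noteq> 0" and rem: "lrem R (L g (d i)) g \<noteq> 0"
    and gd: "UNIV #>\<^bsub>R\<^esub> gd = ann_coset R (d i) g" and l: "is_llcm R gd g l"
  shows "loop_invariant d f b (l, 1)" "degree g < degree l"
proof -
  have l_iff: "h \<in> range (\<lambda>q. L q l) \<longleftrightarrow> L h (d i) \<in> range (\<lambda>q. L q g) \<and> h \<in> range (\<lambda>q. L q g)" for h
    using l gd by (auto simp: is_llcm_def ann_coset_def left_multiples)
  have bg: "range (\<lambda>q. L q b) \<subseteq> range (\<lambda>q. L q g)"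
    using inv by (simp add: loop_invariant_def left_multiples_subset_iff)
  have "L b (d i) \<in> range (\<lambda>q. L q b)"
    using bound(1) by (auto simp: is_bound_def twosided_def left_multiples right_multiples)
  with bg self_left_multiple have b: "b \<in> range (\<lambda>q. L q l)"
    unfolding l_iff by blast
  have lg: "l \<in> range (\<lambda>q. L q g)"
    using l_iff self_left_multiple by blast
  with inv left_multiples_subset_iff have "l \<in> range (\<lambda>q. L q f)"
    unfolding loop_invariant_def by blast
  with b show "loop_invariant d f b (l, 1)"
    by (simp add: loop_invariant_def)
  from b bound(2) have "l \<noteq> 0" by auto
  moreover have "g \<notin> range (\<lambda>q. L q l)"
    using rem \<open>g \<noteq> 0\<close> by (simp add: l_iff lrem_eq_0_iff)
  ultimately show "degree g < degree l"
    using lg \<open>g \<noteq> 0\<close> by (intro degree_less_of_proper_left_multiple)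
qed

lemma advance_step:
  assumes "loop_invariant d f b (g, i)" "g \<noteq> 0" "lrem R (L g (d i)) g = 0"
  shows "loop_invariant d f b (g, i + 1)"
  using assms by (auto simp: loop_invariant_def lrem_eq_0_iff less_Suc_eq)

lemma loop_invariant_step:
  assumes "is_bound R f b" "b \<noteq> 0" "loop_invariant d f b st" "bound_step R s d st st'"
  shows "loop_invariant d f b st'"
  using assms(4,3)
proof cases
  case (advance i g)
  with assms(3) show ?thesis
    using advance_step by simp
next
  case (enlarge i g gd l)
  with assms(1-3) show ?thesis
    using enlarge_step(1) by simp
qed

lemma degree_left_divisor_le:
  assumes "b \<in> range (\<lambda>q. L q g)" "b \<noteq> 0"
  shows "g \<noteq> 0 \<and> degree g \<le> degree b"
proof -
  obtain q where q: "b = L q g" using assms(1) by blast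
  with assms(2) have "q \<noteq> 0" "g \<noteq> 0" by auto
  with q show ?thesis by (simp add: degree_L)
qed

text \<open>The order is lexicographic: advancing keeps \<open>g\<close> and lowers the second
  measure, enlarging lowers the first and may reset the second. With \<open>Suc s\<close>, the
  advance from \<open>i = s\<close> still counts as a decrease. Subtraction is truncated, so
  \<open>degree l \<le> degree b\<close> is checked.\<close>

lemma bound_step_decreases:
  assumes "is_bound R f b" "b \<noteq> 0" "loop_invariant d f b st" "bound_step R s d st st'"
  shows "(st', st) \<in> measures [\<lambda>(g, i). degree b - degree g, \<lambda>(g, i). Suc s - i]"
  using assms(4)
proof cases
  case (advance i g)
  then show ?thesis by auto
next
  case (enlarge i g gd l)
  with assms(1-3) have "loop_invariant d f b (l, 1)" "degree g < degree l"
    using enlarge_step by simp_all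
  moreover from this assms(2) have "degree l \<le> degree b"
    by (simp add: loop_invariant_def degree_left_divisor_le)
  ultimately show ?thesis using enlarge by auto
qed

text \<open>Both left ideals occurring in an enlargement are principal, so the required generators
  exist and a failed test never blocks the loop.\<close>

lemma loop_progress:
  assumes "g \<noteq> 0" "i \<le> s"
  shows "\<exists>st. bound_step R s d (g, i) st"
proof (cases "lrem R (L g (d i)) g = 0")
  case True
  with assms have "bound_step R s d (g, i) (g, i + 1)"
    by (intro bound_step.advance) simp_all
  then show ?thesis ..
next
  case False
  obtain gd where gd: "UNIV #>\<^bsub>R\<^esub> gd = ann_coset R (d i) g"
    using ex_left_generator_ann_coset by blast
  obtain l where "is_llcm R gd g l"
    using ex_llcm by blast
  with assms False gd have "bound_step R s d (g, i) (l, 1)"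
    by (intro bound_step.enlarge[of _ _ _ _ _ gd]) simp_all
  then show ?thesis ..
qed

lemma loop_result:
  assumes "generates_over_center R (d ` {1..s})" "is_bound R f b" "b \<noteq> 0"
    and "loop_invariant d f b (g, i)" "s < i"
  shows "is_bound R f g"
proof -
  have right: "L g h \<in> range (\<lambda>q. L q g)" for h
    by (rule idealizer_eq_UNIV[OF assms(1)]) (use assms(4,5) in \<open>auto simp: loop_invariant_def\<close>)
  have "range (\<lambda>q. L q g) \<subseteq> range (\<lambda>q. L q f)" "range (\<lambda>q. L q b) \<subseteq> range (\<lambda>q. L q g)"
    using assms(4) by (simp_all add: loop_invariant_def left_multiples_subset_iff)
  \<comment> \<open>Rg is now a twosided ideal inside Rf, so the maximality of Rb gives the
    inclusion of Rg in Rb.\<close>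
  with assms(2) ideal_left_multiples[OF right] have "range (\<lambda>q. L q g) = range (\<lambda>q. L q b)"
    by (simp only: is_bound_def left_multiples ore_ring_simps) (meson subset_antisym)
  from is_bound_cong[OF assms(2,3) this right] show ?thesis .
qed

end

text \<open>Generators may be chosen freely, so termination is claimed for every run. The second
  conjunct excludes stuck states while \<open>i \<le> s\<close> and gives correctness at every
  exit.\<close>

theorem theorem2p6:
  fixes \<sigma> \<delta> :: "'a::division_ring \<Rightarrow> 'a"
    and R :: "'a poly ring"
    and s :: nat and d :: "nat \<Rightarrow> 'a poly" and f :: "'a poly"
  assumes "ring_automorphism \<sigma>"
    and "sigma_derivation \<sigma> \<delta>"
    and "R = ore_ring \<sigma> \<delta>"
    and "generates_over_center R (d ` {1..s})"
    and "bounded_elem R f"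
  shows
    "(\<nexists>run :: nat \<Rightarrow> 'a poly \<times> nat.
        run 0 = (f, 1) \<and> (\<forall>k. bound_step R s d (run k) (run (Suc k)))) \<and>
     (\<forall>g i. (bound_step R s d)\<^sup>*\<^sup>* (f, 1) (g, i) \<longrightarrow>
        (if i \<le> s then \<exists>st. bound_step R s d (g, i) st else is_bound R f g))"
proof -
  interpret ore_data \<sigma> \<delta>
    using assms(1,2) by unfold_locales
  note R = assms(3)
  obtain b where b: "is_bound (ore_ring \<sigma> \<delta>) f b" "b \<noteq> 0"
    using assms(5) by (auto simp: bounded_elem_def R)
  then have start: "loop_invariant d f b (f, 1)"
    using left_multiples_subset_iff self_left_multiple
    by (auto simp: loop_invariant_def is_bound_def left_multiples R)
  have "False" if run: "run 0 = (f, 1)" "\<And>k. bound_step R s d (run k) (run (Suc k))" for run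
  proof -
    have "loop_invariant d f b (run k)" for k
    proof (induction k)
      case 0
      show ?case using start run(1) by simp
    next
      case (Suc k)
      show ?case
        by (rule loop_invariant_step[OF b Suc run(2)[of k, unfolded R]])
    qed
    with b have "(run (Suc k), run k)
        \<in> measures [\<lambda>(g, i). degree b - degree g, \<lambda>(g, i). Suc s - i]" for k
      by (rule bound_step_decreases[OF _ _ _ run(2)[unfolded R]])
    then show False
      using wf_measures unfolding wf_iff_no_infinite_down_chain by blast
  qed
  moreover have "if i \<le> s then \<exists>st. bound_step R s d (g, i) st else is_bound R f g"
    if "(bound_step R s d)\<^sup>*\<^sup>* (f, 1) (g, i)" for g i
  proof -
    from that have inv: "loop_invariant d f b (g, i)"
    proof (induction rule: rtranclp_induct)
      case base
      show ?case by (rule start)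
    next
      case (step st st')
      show ?case
        by (rule loop_invariant_step[OF b step.IH step.hyps(2)[unfolded R]])
    qed
    \<comment> \<open>The nonzero \<open>b\<close> is a left multiple of \<open>g\<close>. This
      matters because no step starts from \<open>g = 0\<close>.\<close>
    then have "g \<noteq> 0"
      using b(2) degree_left_divisor_le[of b g] by (simp add: loop_invariant_def)
    with inv b assms(4) show ?thesis
      unfolding R using loop_progress loop_result by (simp del: split_paired_Ex)
  qed
  ultimately show ?thesis by blast
qed

end
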